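(* Let $A=(a_{ij})$ be a $3\times3$ real normal matrix. The following are equivalent: 1. $\breve{A}\le A$ (entrywise); 2. $A=A^{\odot 2}$, i.e. $A$ is idempotent; 3. $\mathcal{T}_A$ is good, i.e. the points of $\mathbb{T}\mathbb{P}^2$ represented by the columns of $A$ define a good tropical triangle.
   Context: $\mathbb{T}=\mathbb{R}\cup\{-\infty\}$ with $a\oplus b=\max\{a,b\}$, $a\odot b=a+b$; $A^{\odot2}=A\odot A$ is the tropical matrix product. $A$ is normal if $a_{ii}=0$ for all $i$ and $a_{ij}\le0$ for all $i,j$. The matrix $\breve{A}=(\beta_{ij})$ is defined by $\beta_{ii}=0$ and $\beta_{ij}=a_{ik}+a_{kj}$ if $i\ne j$ and $\{i,j,k\}=\{1,2,3\}$. $\mathbb{T}\mathbb{P}^2$ is the quotient of $\mathbb{T}^3\setminus\{(-\infty,-\infty,-\infty)\}$ by $(p_1,p_2,p_3)\sim(\lambda+p_1,\lambda+p_2,\lambda+p_3)$, $\lambda\in\mathbb{R}$. $\mathcal{T}_A$ is the tropical span of the columns of $A$ in $\mathbb{T}\mathbb{P}^2$. For $p=[p_1,p_2,p_3]$, the tropical line $L_p$ is the set of $[x_1,x_2,x_3]\in\mathbb{T}\mathbb{P}^2$ such that $\max_j(p_j+x_j)$ is attained at least twice. Put $$p\otimes q=[\max\{p_2+q_3,q_2+p_3\},\ \max\{p_1+q_3,q_1+p_3\},\ \max\{p_1+q_2,q_1+p_2\}].$$ The stable join of points $p,q$ is the line $pq=L_{p\otimes q}$, and the stable intersection of lines is the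 point $L_p\cap_{\mathrm{st}}L_q=p\otimes q$. Three points $a,b,c$ define a good tropical triangle if $$ca\cap_{\mathrm{st}}ab=a,\quad ab\cap_{\mathrm{st}}bc=b,\quad bc\cap_{\mathrm{st}}ca=c.$$ *)

theory Defs
  imports "HOL-Analysis.Analysis"
begin

text \<open>
  The tropical numbers are the extended reals other than \<open>\<infinity>\<close>, with \<open>max\<close> as addition and
  \<open>+\<close> as multiplication; in \<^typ>\<open>ereal\<close>, \<open>-\<infinity> + x = -\<infinity>\<close> whenever \<open>x \<noteq> \<infinity>\<close>.
\<close>

definition trop_mult :: "ereal ^ 'k ^ 'm \<Rightarrow> ereal ^ 'n ^ 'k \<Rightarrow> ereal ^ 'n ^ 'm"
    (infixl \<open>\<odot>\<close> 70) where
  "A \<odot> B = (\<chi> i j. MAX k. A $ i $ k + B $ k $ j)"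

definition normal_mat :: "ereal ^ 'n ^ 'n \<Rightarrow> bool" where
  "normal_mat A \<longleftrightarrow> (\<forall>i. A $ i $ i = 0) \<and> (\<forall>i j. A $ i $ j \<le> 0)"

definition breve :: "ereal ^ 3 ^ 3 \<Rightarrow> ereal ^ 3 ^ 3" where
  "breve A = (\<chi> i j. if i = j then 0
     else (let k = (THE k. {i, j, k} = {1, 2, 3}) in A $ i $ k + A $ k $ j))"

definition hom_coords :: "(ereal ^ 3) set" where
  "hom_coords = {p. \<forall>i. p $ i \<noteq> \<infinity>} - {\<chi> i. -\<infinity>}"

definition proj_rel :: "((ereal ^ 3) \<times> (ereal ^ 3)) set" where
  "proj_rel = {(p, q). p \<in> hom_coords \<and> q \<in> hom_coords \<and>
     (\<exists>c::real. \<forall>i. q $ i = ereal c + p $ i)}"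

definition trop_plane :: "(ereal ^ 3) set set" where
  "trop_plane = hom_coords // proj_rel"

text \<open>
  \<open>proj_point p\<close> is the point \<open>[p\<^sub>1, p\<^sub>2, p\<^sub>3]\<close>; it is \<open>{}\<close>, which is not a point of the plane,
  if \<open>p\<close> is not a vector of homogeneous coordinates.
\<close>

definition proj_point :: "ereal ^ 3 \<Rightarrow> (ereal ^ 3) set" where
  "proj_point p = proj_rel `` {p}"

definition trop_line :: "(ereal ^ 3) set \<Rightarrow> (ereal ^ 3) set set" where
  "trop_line P = {X \<in> trop_plane. \<exists>p\<in>P. \<exists>x\<in>X.
     2 \<le> card {j. p $ j + x $ j = (MAX k. p $ k + x $ k)}}"

definition tensor_vec :: "ereal ^ 3 \<Rightarrow> ereal ^ 3 \<Rightarrow> ereal ^ 3" where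
  "tensor_vec p q = vector
     [max (p $ 2 + q $ 3) (q $ 2 + p $ 3),
      max (p $ 1 + q $ 3) (q $ 1 + p $ 3),
      max (p $ 1 + q $ 2) (q $ 1 + p $ 2)]"

text \<open>
  The three operations below are partial: \<open>p \<otimes> q\<close> can have all coordinates \<open>-\<infinity>\<close>, for example
  if \<open>p = q = [0, -\<infinity>, -\<infinity>]\<close>. Undefined results are \<open>{}\<close>, which is neither a point nor a line.
  The unions run over representatives, respectively over coefficients of the two lines; by the
  lemmas \<open>tensor_proj_point\<close> and \<open>stable_meet_trop_line\<close> the result does not depend on them.
\<close>

definition tensor :: "(ereal ^ 3) set \<Rightarrow> (ereal ^ 3) set \<Rightarrow> (ereal ^ 3) set" where
  "tensor P Q = (\<Union>p\<in>P. \<Union>q\<in>Q. proj_point (tensor_vec p q))"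

definition stable_join :: "(ereal ^ 3) set \<Rightarrow> (ereal ^ 3) set \<Rightarrow> (ereal ^ 3) set set" where
  "stable_join P Q = trop_line (tensor P Q)"

definition stable_meet :: "(ereal ^ 3) set set \<Rightarrow> (ereal ^ 3) set set \<Rightarrow> (ereal ^ 3) set" where
  "stable_meet L M = \<Union> {tensor P Q |P Q.
     P \<in> trop_plane \<and> Q \<in> trop_plane \<and> L = trop_line P \<and> M = trop_line Q}"

definition good_triangle ::
    "(ereal ^ 3) set \<Rightarrow> (ereal ^ 3) set \<Rightarrow> (ereal ^ 3) set \<Rightarrow> bool" where
  "good_triangle a b c \<longleftrightarrow> a \<in> trop_plane \<and> b \<in> trop_plane \<and> c \<in> trop_plane \<and>
     stable_meet (stable_join c a) (stable_join a b) = a \<and>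
     stable_meet (stable_join a b) (stable_join b c) = b \<and>
     stable_meet (stable_join b c) (stable_join c a) = c"


lemma proj_relI:
  assumes "p \<in> hom_coords" "\<And>i. q $ i = ereal c + p $ i"
  shows "(p, q) \<in> proj_rel"
proof -
  have "q $ i = \<infinity> \<longleftrightarrow> p $ i = \<infinity>" "q $ i = -\<infinity> \<longleftrightarrow> p $ i = -\<infinity>" for i
    using assms(2)[of i] by (cases "p $ i"; simp)+
  then have "q \<in> hom_coords"
    using assms(1) by (auto simp: hom_coords_def vec_eq_iff)
  then show ?thesis
    using assms unfolding proj_rel_def by blast
qed

lemma equiv_proj_rel: "equiv hom_coords proj_rel"
proof (rule equivI)
  show "proj_rel \<subseteq> hom_coords \<times> hom_coords" by (auto simp: proj_rel_def)
  show "refl_on hom_coords proj_rel"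
  proof (rule refl_onI)
    fix p assume "p \<in> hom_coords"
    then show "(p, p) \<in> proj_rel" by (rule proj_relI[where c = 0]) (simp add: zero_ereal_def[symmetric])
  qed
  show "sym proj_rel"
  proof (rule symI)
    fix p q assume pq: "(p, q) \<in> proj_rel"
    then obtain c where c: "\<And>i. q $ i = ereal c + p $ i" and q: "q \<in> hom_coords"
      unfolding proj_rel_def by blast
    have "p $ i = ereal (-c) + q $ i" for i
      using c[of i] by (cases "p $ i") auto
    with q show "(q, p) \<in> proj_rel" by (rule proj_relI)
  qed
  show "trans proj_rel"
  proof (rule transI)
    fix p q r assume "(p, q) \<in> proj_rel" "(q, r) \<in> proj_rel"
    then obtain c d where c: "\<And>i. q $ i = ereal c + p $ i" "\<And>i. r $ i = ereal d + q $ i"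
      and p: "p \<in> hom_coords"
      unfolding proj_rel_def by blast
    have "r $ i = ereal (d + c) + p $ i" for i
      using c[of i] by (cases "p $ i") auto
    with p show "(p, r) \<in> proj_rel" by (rule proj_relI)
  qed
qed

lemma proj_point_mem: "p \<in> hom_coords \<Longrightarrow> p \<in> proj_point p"
  unfolding proj_point_def by (rule equiv_class_self[OF equiv_proj_rel])

lemma proj_point_in_plane: "p \<in> hom_coords \<Longrightarrow> proj_point p \<in> trop_plane"
  unfolding proj_point_def trop_plane_def by (rule quotientI)

lemma trop_planeE:
  assumes "P \<in> trop_plane"
  obtains p where "p \<in> hom_coords" "P = proj_point p"
  using assms unfolding trop_plane_def proj_point_def by (rule quotientE)

lemma proj_point_eq: "(p, q) \<in> proj_rel \<Longrightarrow> proj_point p = proj_point q"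
  unfolding proj_point_def by (rule equiv_class_eq[OF equiv_proj_rel])

lemma mem_proj_pointD: "q \<in> proj_point p \<Longrightarrow> \<exists>c::real. \<forall>i. q $ i = ereal c + p $ i"
  by (simp add: proj_point_def proj_rel_def)

lemma tensor_vec_nth:
  "tensor_vec p q $ 1 = max (p $ 2 + q $ 3) (q $ 2 + p $ 3)"
  "tensor_vec p q $ 2 = max (p $ 1 + q $ 3) (q $ 1 + p $ 3)"
  "tensor_vec p q $ 3 = max (p $ 1 + q $ 2) (q $ 1 + p $ 2)"
  by (simp_all add: tensor_vec_def)

lemma ereal_max_shift: "max (ereal c + x) (ereal c + y) = ereal c + max x (y::ereal)"
  by (cases x; cases y) (auto simp: max_def)

lemma tensor_proj_point:
  assumes p: "p \<in> hom_coords" and q: "q \<in> hom_coords"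
  shows "tensor (proj_point p) (proj_point q) = proj_point (tensor_vec p q)"
proof -
  have *: "proj_point (tensor_vec p' q') = proj_point (tensor_vec p q)"
    if p': "p' \<in> proj_point p" and q': "q' \<in> proj_point q" for p' q'
  proof -
    obtain c where c: "\<And>i. p' $ i = ereal c + p $ i" using mem_proj_pointD[OF p'] by blast
    obtain d where d: "\<And>i. q' $ i = ereal d + q $ i" using mem_proj_pointD[OF q'] by blast
    have sum: "p' $ i + q' $ j = ereal (c + d) + (p $ i + q $ j)"
        "q' $ i + p' $ j = ereal (c + d) + (q $ i + p $ j)" for i j
      unfolding c d by (cases "p $ i"; cases "q $ j"; simp; cases "p $ j"; cases "q $ i"; simp)
        (cases "p $ j"; cases "q $ i"; simp)
    have shift: "tensor_vec p' q' $ i = ereal (c + d) + tensor_vec p q $ i" for i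
      using exhaust_3[of i] by (auto simp only: tensor_vec_nth sum ereal_max_shift)
    show ?thesis
    proof (cases "tensor_vec p q \<in> hom_coords")
      case True
      from proj_relI[OF this shift] show ?thesis by (rule proj_point_eq[symmetric])
    next
      case False
      have "tensor_vec p q $ i = ereal (- (c + d)) + tensor_vec p' q' $ i" for i
        using shift[of i] by (cases "tensor_vec p q $ i") auto
      then have "tensor_vec p' q' \<notin> hom_coords"
        using False proj_relI[of "tensor_vec p' q'" "tensor_vec p q"]
        by (auto simp: proj_rel_def)
      with False show ?thesis by (auto simp: proj_point_def proj_rel_def)
    qed
  qed
  show ?thesis
    using * proj_point_mem[OF p] proj_point_mem[OF q] unfolding tensor_def by blast
qed

lemma max_attained_twice_iff:
  fixes f :: "3 \<Rightarrow> ereal"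
  shows "2 \<le> card {j. f j = (MAX k. f k)} \<longleftrightarrow> (\<exists>i j. i \<noteq> j \<and> f i = f j \<and> (\<forall>k. f k \<le> f i))"
proof
  assume "2 \<le> card {j. f j = (MAX k. f k)}"
  then obtain i j where "i \<noteq> j" "f i = (MAX k. f k)" "f j = (MAX k. f k)"
    by (auto simp: numeral_2_eq_2 card_le_Suc_iff)
  then show "\<exists>i j. i \<noteq> j \<and> f i = f j \<and> (\<forall>k. f k \<le> f i)" by fastforce
next
  assume "\<exists>i j. i \<noteq> j \<and> f i = f j \<and> (\<forall>k. f k \<le> f i)"
  then obtain i j where ij: "i \<noteq> j" "f i = f j" "\<forall>k. f k \<le> f i" by blast
  then have "(MAX k. f k) = f i" by (intro Max_eqI) auto
  with ij have "card {i, j} \<le> card {j. f j = (MAX k. f k)}" by (intro card_mono) auto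
  with ij show "2 \<le> card {j. f j = (MAX k. f k)}" by simp
qed

lemma proj_point_in_trop_line_iff:
  assumes p: "p \<in> hom_coords" and x: "x \<in> hom_coords"
  shows "proj_point x \<in> trop_line (proj_point p) \<longleftrightarrow>
    (\<exists>i j. i \<noteq> j \<and> p $ i + x $ i = p $ j + x $ j \<and> (\<forall>k. p $ k + x $ k \<le> p $ i + x $ i))"
    (is "_ \<longleftrightarrow> ?R p x")
proof -
  have *: "?R p x" if p': "p' \<in> proj_point p" and x': "x' \<in> proj_point x" and R: "?R p' x'" for p' x'
  proof -
    obtain c where c: "\<And>i. p' $ i = ereal c + p $ i" using mem_proj_pointD[OF p'] by blast
    obtain d where d: "\<And>i. x' $ i = ereal d + x $ i" using mem_proj_pointD[OF x'] by blast
    have sum: "p' $ i + x' $ i = ereal (c + d) + (p $ i + x $ i)" for i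
      unfolding c d by (cases "p $ i"; cases "x $ i") auto
    have "ereal e + u \<le> ereal e + v \<longleftrightarrow> u \<le> v" "ereal e + u = ereal e + v \<longleftrightarrow> u = v" for e u v
      by (cases u; cases v; simp)+
    with R show ?thesis unfolding sum by simp
  qed
  show ?thesis
    unfolding trop_line_def max_attained_twice_iff[where f = "\<lambda>k. _ $ k + _ $ k"] mem_Collect_eq
    using * proj_point_in_plane[OF x] proj_point_mem[OF p] proj_point_mem[OF x] by blast
qed

lemma trop_line_inj:
  assumes P: "P \<in> trop_plane" and Q: "Q \<in> trop_plane" and eq: "trop_line P = trop_line Q"
  shows "P = Q"
proof -
  obtain p where p: "p \<in> hom_coords" "P = proj_point p" using P by (rule trop_planeE)
  obtain q where q: "q \<in> hom_coords" "Q = proj_point q" using Q by (rule trop_planeE)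
  have np: "p $ i \<noteq> \<infinity>" "q $ i \<noteq> \<infinity>" for i using p q by (auto simp: hom_coords_def)
  have line: "(\<exists>i j. i \<noteq> j \<and> p $ i + x $ i = p $ j + x $ j \<and> (\<forall>k. p $ k + x $ k \<le> p $ i + x $ i))
    \<longleftrightarrow> (\<exists>i j. i \<noteq> j \<and> q $ i + x $ i = q $ j + x $ j \<and> (\<forall>k. q $ k + x $ k \<le> q $ i + x $ i))"
    if "x \<in> hom_coords" for x
    using proj_point_in_trop_line_iff[OF p(1) that] proj_point_in_trop_line_iff[OF q(1) that]
      eq p(2) q(2) by simp
  have supp: "(\<exists>i j. i \<noteq> j \<and> r $ i + x $ i = r $ j + x $ j \<and> (\<forall>k. r $ k + x $ k \<le> r $ i + x $ i))
      \<longleftrightarrow> r $ m = -\<infinity>" if r: "\<And>i. r $ i \<noteq> \<infinity>" and x: "x = (\<chi> i. if i = m then 0 else -\<infinity>)"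
    for r x :: "ereal ^ 3" and m
  proof -
    have v: "r $ i + x $ i = (if i = m then r $ m else -\<infinity>)" for i
      using r[of i] unfolding x by (cases "r $ i") auto
    obtain i j :: 3 where ij: "i \<noteq> j" by (metis exhaust_3 zero_neq_one)
    show ?thesis
    proof
      assume "\<exists>i j. i \<noteq> j \<and> r $ i + x $ i = r $ j + x $ j \<and> (\<forall>k. r $ k + x $ k \<le> r $ i + x $ i)"
      then obtain i j where "i \<noteq> j" "r $ i + x $ i = r $ j + x $ j" "r $ m + x $ m \<le> r $ i + x $ i"
        by blast
      then show "r $ m = -\<infinity>" unfolding v by (auto split: if_splits)
    next
      assume "r $ m = -\<infinity>"
      then have "r $ i + x $ i = -\<infinity>" for i unfolding v by simp
      then show "\<exists>i j. i \<noteq> j \<and> r $ i + x $ i = r $ j + x $ j \<and> (\<forall>k. r $ k + x $ k \<le> r $ i + x $ i)"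
        using ij by (intro exI[of _ i] exI[of _ j]) (simp only: order_refl simp_thms)
    qed
  qed
  have same_supp: "p $ m = -\<infinity> \<longleftrightarrow> q $ m = -\<infinity>" for m
  proof -
    define x where x: "x = (\<chi> i. if i = m then 0 else (-\<infinity> :: ereal))"
    have "x \<in> hom_coords" unfolding x hom_coords_def by (auto simp: vec_eq_iff)
    from line[OF this] show ?thesis using supp[OF np(1) x] supp[OF np(2) x] by simp
  qed
  have diff: "q $ m - p $ m = q $ n - p $ n"
    if mn: "m \<noteq> n" "p $ m \<noteq> -\<infinity>" "p $ n \<noteq> -\<infinity>" for m n
  proof -
    define x where x: "x = (\<chi> i. if i = m \<or> i = n then - (p $ i) else -\<infinity>)"
    have x0: "x \<in> hom_coords"
      using mn np unfolding x hom_coords_def by (auto simp: vec_eq_iff ereal_uminus_eq_reorder)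
    have px: "p $ i + x $ i = (if i = m \<or> i = n then 0 else -\<infinity>)" for i
      using np(1)[of i] mn unfolding x by (cases "p $ i") auto
    have qx: "q $ i + x $ i = (if i = m \<or> i = n then q $ i - p $ i else -\<infinity>)" for i
      using np[of i] mn unfolding x by (cases "q $ i") (auto simp: minus_ereal_def)
    have "q $ i - p $ i \<noteq> -\<infinity>" if "i = m \<or> i = n" for i
      using np[of i] that mn same_supp[of i] by (cases "q $ i"; cases "p $ i") auto
    then have fin: "q $ m - p $ m \<noteq> -\<infinity>" "q $ n - p $ n \<noteq> -\<infinity>" by auto
    have "m \<noteq> n \<and> p $ m + x $ m = p $ n + x $ n \<and> (\<forall>k. p $ k + x $ k \<le> p $ m + x $ m)"
      unfolding px using mn by auto
    then obtain i j where ij: "i \<noteq> j" "q $ i + x $ i = q $ j + x $ j"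
      "\<And>k. q $ k + x $ k \<le> q $ i + x $ i" using line[OF x0] by blast
    show ?thesis
      using ij(1,2) ij(3)[of m] ij(3)[of n] fin mn(1) unfolding qx by (auto split: if_splits)
  qed
  obtain m where m: "p $ m \<noteq> -\<infinity>" using p(1) by (auto simp: hom_coords_def vec_eq_iff)
  then obtain u v where uv: "p $ m = ereal u" "q $ m = ereal v"
    using np[of m] same_supp[of m] by (cases "p $ m"; cases "q $ m") auto
  have "q $ i = ereal (v - u) + p $ i" for i
  proof (cases "i = m \<or> p $ i = -\<infinity>")
    case True
    then show ?thesis using uv same_supp[of i] by auto
  next
    case False
    then show ?thesis
      using diff[of m i] m uv np[of i] same_supp[of i] by (cases "p $ i"; cases "q $ i") auto
  qed
  then show ?thesis using proj_point_eq[OF proj_relI[OF p(1)]] p(2) q(2) by blast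
qed

lemma stable_meet_trop_line:
  assumes "P \<in> trop_plane" "Q \<in> trop_plane"
  shows "stable_meet (trop_line P) (trop_line Q) = tensor P Q"
proof -
  have "{tensor P' Q' |P' Q'. P' \<in> trop_plane \<and> Q' \<in> trop_plane \<and>
      trop_line P = trop_line P' \<and> trop_line Q = trop_line Q'} = {tensor P Q}"
    using assms trop_line_inj by blast
  then show ?thesis unfolding stable_meet_def by simp
qed

end

theory Submission
  imports Defs
begin

text \<open>
  Each of the three conditions is the system of six inequalities
  \<open>a\<^bsub>ik\<^esub> + a\<^bsub>kj\<^esub> \<le> a\<^bsub>ij\<^esub>\<close> with \<open>i\<close>, \<open>j\<close>, \<open>k\<close> distinct.

  For \<open>breve A \<le> A\<close> this is the definition off the diagonal. For idempotence, the zero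
  diagonal of a normal matrix makes \<open>A \<le> A \<odot> A\<close> automatic, so that only the inequalities
  \<open>a\<^bsub>ik\<^esub> + a\<^bsub>kj\<^esub> \<le> a\<^bsub>ij\<^esub>\<close> for all \<open>i\<close>, \<open>j\<close>, \<open>k\<close> are left (\<open>normal_idempotent_iff\<close>);
  those with two equal indices hold because the diagonal is zero and all entries are nonpositive.

  For goodness, a line determines its coefficients up to a common tropical factor, so the
  condition at the vertex \<open>a\<close> is the equality of the projective points
  \<open>(c \<otimes> a) \<otimes> (a \<otimes> b)\<close> and \<open>a\<close>. The vector \<open>(c \<otimes> a) \<otimes> (a \<otimes> b)\<close> has first coordinate
  \<open>0\<close>, as has the first column \<open>a\<close> itself, so the two points are equal if and only if the two
  vectors are. Comparing the other two coordinates gives exactly the two inequalities with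
  \<open>j = 1\<close> (\<open>tensor_vertex_iff\<close>). The definition of \<open>\<otimes>\<close> is symmetric in the three
  coordinates, so the same computation at \<open>b\<close> and \<open>c\<close> gives the other four.
\<close>

lemma sum_le_of_nonpos:
  fixes x y :: ereal
  assumes "x \<le> 0" "y \<le> 0"
  shows "x + y \<le> x" "x + y \<le> y"
  using add_mono[OF order_refl assms(2), of x] add_mono[OF assms(1) order_refl, of y] by simp_all

text \<open>
  The terms with \<open>k = i\<close> of the maximum that defines \<open>A \<odot> A\<close> are the entries of \<open>A\<close>, so only
  the upper bound on the maximum is a condition.
\<close>

lemma normal_idempotent_iff:
  fixes A :: "ereal ^ 'n ^ 'n"
  assumes "normal_mat A"
  shows "A = A \<odot> A \<longleftrightarrow> (\<forall>i j k. A $ i $ k + A $ k $ j \<le> A $ i $ j)"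
proof
  assume "A = A \<odot> A"
  then have "A $ i $ j = (A \<odot> A) $ i $ j" for i j by (rule arg_cong)
  then have "A $ i $ j = (MAX k. A $ i $ k + A $ k $ j)" for i j
    unfolding trop_mult_def vec_lambda_beta .
  moreover have "A $ i $ k + A $ k $ j \<le> (MAX k. A $ i $ k + A $ k $ j)" for i j k by simp
  ultimately show "\<forall>i j k. A $ i $ k + A $ k $ j \<le> A $ i $ j" by metis
next
  assume le: "\<forall>i j k. A $ i $ k + A $ k $ j \<le> A $ i $ j"
  have "(MAX k. A $ i $ k + A $ k $ j) = A $ i $ j" for i j
  proof (rule Max_eqI)
    have "A $ i $ j = A $ i $ i + A $ i $ j" using assms by (simp add: normal_mat_def)
    then show "A $ i $ j \<in> range (\<lambda>k. A $ i $ k + A $ k $ j)" by blast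
  qed (use le in auto)
  then show "A = A \<odot> A" by (simp add: trop_mult_def vec_eq_iff)
qed

lemma UNIV_3_of_distinct:
  fixes i j k :: 3
  assumes "i \<noteq> j" "j \<noteq> k" "k \<noteq> i"
  shows "(UNIV :: 3 set) = {i, j, k}"
proof -
  have "x = i \<or> x = j \<or> x = k" for x
    using exhaust_3[of x] exhaust_3[of i] exhaust_3[of j] exhaust_3[of k] assms by metis
  then show ?thesis by blast
qed

lemma ex_third_index:
  fixes i j :: 3
  assumes "i \<noteq> j"
  obtains k where "j \<noteq> k" "k \<noteq> i"
proof -
  have "card {i, j} \<noteq> card (UNIV :: 3 set)" using assms by simp
  then have "UNIV \<noteq> {i, j}" by metis
  then obtain k where "k \<notin> {i, j}" by blast
  with that[of k] show thesis by auto
qed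

lemma breve_nth:
  assumes "i \<noteq> j" "j \<noteq> k" "k \<noteq> i"
  shows "breve A $ i $ j = A $ i $ k + A $ k $ j"
proof -
  have "(THE k. {i, j, k} = {1, 2, 3}) = k"
  proof (rule the_equality)
    show "{i, j, k} = {1, 2, 3}" using UNIV_3_of_distinct[OF assms] UNIV_3 by simp
  next
    fix l assume "{i, j, l} = {1, 2, 3}"
    then have "k \<in> {i, j, l}" using UNIV_3 by (metis UNIV_I)
    then show "l = k" using assms by auto
  qed
  then show ?thesis using assms(1) by (simp add: breve_def)
qed

lemma breve_le_iff:
  assumes "normal_mat A"
  shows "breve A \<le> A \<longleftrightarrow>
    (\<forall>i j k. i \<noteq> j \<longrightarrow> j \<noteq> k \<longrightarrow> k \<noteq> i \<longrightarrow> A $ i $ k + A $ k $ j \<le> A $ i $ j)"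
proof
  assume "breve A \<le> A"
  then have "breve A $ i $ j \<le> A $ i $ j" for i j by (simp add: less_eq_vec_def)
  then show "\<forall>i j k. i \<noteq> j \<longrightarrow> j \<noteq> k \<longrightarrow> k \<noteq> i \<longrightarrow> A $ i $ k + A $ k $ j \<le> A $ i $ j"
    by (metis breve_nth)
next
  assume le: "\<forall>i j k. i \<noteq> j \<longrightarrow> j \<noteq> k \<longrightarrow> k \<noteq> i \<longrightarrow> A $ i $ k + A $ k $ j \<le> A $ i $ j"
  have "breve A $ i $ j \<le> A $ i $ j" for i j
  proof (cases "i = j")
    case True
    then show ?thesis using assms by (simp add: breve_def normal_mat_def)
  next
    case False
    then obtain k where "j \<noteq> k" "k \<noteq> i" by (rule ex_third_index)
    with False le show ?thesis by (simp add: breve_nth)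
  qed
  then show "breve A \<le> A" by (simp add: less_eq_vec_def)
qed

lemma breve_le_iff_idempotent:
  assumes "normal_mat A"
  shows "breve A \<le> A \<longleftrightarrow> A = A \<odot> A"
proof -
  have "A $ i $ k + A $ k $ j \<le> A $ i $ j" if "i = j \<or> j = k \<or> k = i" for i j k
  proof -
    have "A $ i $ k \<le> 0" "A $ k $ j \<le> 0" "A $ l $ l = 0" for l
      using assms by (simp_all add: normal_mat_def)
    then show ?thesis
      using that sum_le_of_nonpos[of "A $ i $ k" "A $ k $ j"] add_nonpos_nonpos by metis
  qed
  then show ?thesis
    unfolding breve_le_iff[OF assms] normal_idempotent_iff[OF assms] by blast
qed

lemma finite_in_hom_coords:
  assumes "\<And>i. \<bar>p $ i\<bar> \<noteq> \<infinity>"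
  shows "p \<in> hom_coords"
proof -
  have "p $ i \<noteq> \<infinity>" "p $ i \<noteq> -\<infinity>" for i using assms[of i] by auto
  then show ?thesis by (simp add: hom_coords_def vec_eq_iff)
qed

lemma tensor_vec_nth_distinct:
  assumes "i \<noteq> j" "j \<noteq> k" "k \<noteq> i"
  shows "tensor_vec p q $ i = max (p $ j + q $ k) (q $ j + p $ k)"
  using exhaust_3[of i] exhaust_3[of j] exhaust_3[of k] assms
  by (auto simp: tensor_vec_nth max.commute add.commute)

lemma tensor_vec_finite:
  assumes "\<And>i. \<bar>p $ i\<bar> \<noteq> \<infinity>" "\<And>i. \<bar>q $ i\<bar> \<noteq> \<infinity>"
  shows "\<bar>tensor_vec p q $ i\<bar> \<noteq> \<infinity>"
proof -
  have "\<bar>max (p $ j + q $ k) (q $ j + p $ k)\<bar> \<noteq> \<infinity>" for j k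
    using assms(1)[of j] assms(1)[of k] assms(2)[of j] assms(2)[of k] by (auto simp: max_def)
  then show ?thesis using exhaust_3[of i] by (elim disjE) (simp_all only: tensor_vec_nth not_False_eq_True)
qed

lemma proj_point_eq_iff_normalized:
  assumes "p \<in> hom_coords" "p $ i = 0" "q $ i = 0"
  shows "proj_point q = proj_point p \<longleftrightarrow> q = p"
proof
  assume "proj_point q = proj_point p"
  then have "p \<in> proj_point q" using proj_point_mem[OF assms(1)] by simp
  then obtain c where c: "\<And>m. p $ m = ereal c + q $ m" using mem_proj_pointD by blast
  have "c = 0" using c[of i] assms(2,3) by simp
  then show "q = p" using c by (simp add: vec_eq_iff flip: zero_ereal_def)
qed simp

text \<open>
  With \<open>u = r \<otimes> p\<close> and \<open>v = p \<otimes> q\<close> the normalization gives \<open>u\<^sub>j = v\<^sub>k = 0\<close>, so \<open>u \<otimes> v\<close> has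
  coordinates \<open>max 0 (v\<^sub>j + u\<^sub>k) = 0\<close> at \<open>i\<close>, \<open>max u\<^sub>i (v\<^sub>i + u\<^sub>k)\<close> at \<open>j\<close> and
  \<open>max (u\<^sub>i + v\<^sub>j) v\<^sub>i\<close> at \<open>k\<close>. Here \<open>u\<^sub>i = max (r\<^sub>j + p\<^sub>k) p\<^sub>j\<close> and
  \<open>v\<^sub>i = max (p\<^sub>j + q\<^sub>k) p\<^sub>k\<close> are at least \<open>p\<^sub>j\<close> and \<open>p\<^sub>k\<close>, hence equality with \<open>p\<close> forces the two
  inequalities; conversely these give \<open>u\<^sub>i = p\<^sub>j\<close> and \<open>v\<^sub>i = p\<^sub>k\<close>, and with the signs of the entries
  they bound the mixed terms \<open>v\<^sub>i + u\<^sub>k\<close> by \<open>p\<^sub>j\<close> and \<open>u\<^sub>i + v\<^sub>j\<close> by \<open>p\<^sub>k\<close>.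
\<close>

lemma tensor_vertex_iff:
  fixes p q r :: "ereal ^ 3"
  assumes ijk: "i \<noteq> j" "j \<noteq> k" "k \<noteq> i"
    and fin: "\<And>m. \<bar>p $ m\<bar> \<noteq> \<infinity>" "\<And>m. \<bar>q $ m\<bar> \<noteq> \<infinity>" "\<And>m. \<bar>r $ m\<bar> \<noteq> \<infinity>"
    and zero: "p $ i = 0" "q $ j = 0" "r $ k = 0"
    and nonpos: "\<And>m. p $ m \<le> 0" "\<And>m. q $ m \<le> 0" "\<And>m. r $ m \<le> 0"
  shows "proj_point (tensor_vec (tensor_vec r p) (tensor_vec p q)) = proj_point p \<longleftrightarrow>
    r $ j + p $ k \<le> p $ j \<and> q $ k + p $ j \<le> p $ k"
proof -
  let ?t = "tensor_vec (tensor_vec r p) (tensor_vec p q)"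
  obtain pj pk qi qk ri rj where real: "p $ j = ereal pj" "p $ k = ereal pk"
    "q $ i = ereal qi" "q $ k = ereal qk" "r $ i = ereal ri" "r $ j = ereal rj"
    using fin by (metis ereal_real)
  have neg: "pj \<le> 0" "pk \<le> 0" "qi \<le> 0" "qk \<le> 0" "ri \<le> 0" "rj \<le> 0"
    using nonpos(1)[of j] nonpos(1)[of k] nonpos(2)[of i] nonpos(2)[of k]
      nonpos(3)[of i] nonpos(3)[of j] unfolding real by simp_all
  note nth = tensor_vec_nth_distinct[OF ijk] tensor_vec_nth_distinct[OF ijk(2,3,1)]
    tensor_vec_nth_distinct[OF ijk(3,1,2)]
  have ti: "?t $ i = ereal (max (max (pk + ri) 0 + max 0 (pj + qi))
      (max qk (pk + qi) + max (ri + pj) rj))"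
    unfolding nth unfolding real zero zero_ereal_def
    by (simp add: ac_simps del: ereal_max flip: ereal_max)
  have tj: "?t $ j = ereal (max (max (ri + pj) rj + max (pj + qk) pk)
      (max 0 (pj + qi) + max (rj + pk) pj))"
    unfolding nth unfolding real zero zero_ereal_def
    by (simp add: ac_simps del: ereal_max flip: ereal_max)
  have tk: "?t $ k = ereal (max (max (rj + pk) pj + max qk (pk + qi))
      (max (pj + qk) pk + max (pk + ri) 0))"
    unfolding nth unfolding real zero zero_ereal_def
    by (simp add: ac_simps del: ereal_max flip: ereal_max)
  have "?t $ i = 0" unfolding ti zero_ereal_def using neg by (smt (verit))
  then have "proj_point ?t = proj_point p \<longleftrightarrow> ?t = p"
    using proj_point_eq_iff_normalized[OF finite_in_hom_coords] fin(1) zero(1) by blast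
  also have "\<dots> \<longleftrightarrow> (\<forall>m \<in> {i, j, k}. ?t $ m = p $ m)"
    unfolding UNIV_3_of_distinct[OF ijk, symmetric] by (simp only: vec_eq_iff ball_UNIV)
  also have "\<dots> \<longleftrightarrow> ?t $ j = p $ j \<and> ?t $ k = p $ k"
    using \<open>?t $ i = 0\<close> zero(1) by simp
  also have "\<dots> \<longleftrightarrow> rj + pk \<le> pj \<and> qk + pj \<le> pk"
  proof -
    have "max 0 (pj + qi) = 0" "max (pk + ri) 0 = 0" using neg by simp_all
    then have eqs: "?t $ j = p $ j \<and> ?t $ k = p $ k \<longleftrightarrow>
        max (max (ri + pj) rj + max (pj + qk) pk) (max (rj + pk) pj) = pj \<and>
        max (max (rj + pk) pj + max qk (pk + qi)) (max (pj + qk) pk) = pk"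
      unfolding tj tk real ereal.inject by simp
    show ?thesis
    proof
      assume "?t $ j = p $ j \<and> ?t $ k = p $ k"
      then have "max (rj + pk) pj \<le> pj" "max (pj + qk) pk \<le> pk"
        unfolding eqs by (metis max.cobounded2)+
      then show "rj + pk \<le> pj \<and> qk + pj \<le> pk" by simp
    next
      assume le: "rj + pk \<le> pj \<and> qk + pj \<le> pk"
      then have "max (rj + pk) pj = pj" "max (pj + qk) pk = pk" by simp_all
      moreover have "max (ri + pj) rj + pk \<le> pj" "pj + max qk (pk + qi) \<le> pk"
        using le neg by (auto simp: max_def)
      ultimately show "?t $ j = p $ j \<and> ?t $ k = p $ k" unfolding eqs by simp
    qed
  qed
  finally show ?thesis by (simp add: real)
qed

lemma stable_meet_join_proj_point:
  assumes "\<And>i. \<bar>p $ i\<bar> \<noteq> \<infinity>" "\<And>i. \<bar>q $ i\<bar> \<noteq> \<infinity>" "\<And>i. \<bar>r $ i\<bar> \<noteq> \<infinity>"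
  shows "stable_meet (stable_join (proj_point r) (proj_point p))
      (stable_join (proj_point p) (proj_point q)) =
    proj_point (tensor_vec (tensor_vec r p) (tensor_vec p q))"
  unfolding stable_join_def
  by (simp add: assms finite_in_hom_coords tensor_proj_point stable_meet_trop_line
      proj_point_in_plane tensor_vec_finite)

lemma good_triangle_iff_breve_le:
  fixes A :: "ereal ^ 3 ^ 3"
  assumes real: "\<And>i j. \<bar>A $ i $ j\<bar> \<noteq> \<infinity>"
    and normal: "normal_mat A"
  shows "good_triangle (proj_point (column 1 A)) (proj_point (column 2 A))
      (proj_point (column 3 A)) \<longleftrightarrow> breve A \<le> A"
proof -
  have fin: "\<bar>column j A $ i\<bar> \<noteq> \<infinity>" for i j using real by (simp add: column_def)
  have plane: "proj_point (column j A) \<in> trop_plane" for j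
    using fin by (intro proj_point_in_plane finite_in_hom_coords)
  have vertex: "stable_meet (stable_join (proj_point (column k A)) (proj_point (column i A)))
        (stable_join (proj_point (column i A)) (proj_point (column j A))) = proj_point (column i A)
      \<longleftrightarrow> A $ j $ k + A $ k $ i \<le> A $ j $ i \<and> A $ k $ j + A $ j $ i \<le> A $ k $ i"
    if "i \<noteq> j" "j \<noteq> k" "k \<noteq> i" for i j k
    using tensor_vertex_iff[OF that, of "column i A" "column j A" "column k A"] fin normal
    unfolding stable_meet_join_proj_point[OF fin fin fin] by (simp add: column_def normal_mat_def)
  have "(1::3) \<noteq> 2" "(2::3) \<noteq> 3" "(3::3) \<noteq> 1" by simp_all
  then show ?thesis
    unfolding good_triangle_def breve_le_iff[OF normal] forall_3
    using plane vertex[of 1 2 3] vertex[of 2 3 1] vertex[of 3 1 2] by auto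
qed

theorem lemma2:
  fixes A :: "ereal ^ 3 ^ 3"
  assumes real: "\<And>i j. \<bar>A $ i $ j\<bar> \<noteq> \<infinity>"
    and normal: "normal_mat A"
  shows "(breve A \<le> A \<longleftrightarrow> A = A \<odot> A) \<and>
    (A = A \<odot> A \<longleftrightarrow>
      good_triangle (proj_point (column 1 A)) (proj_point (column 2 A)) (proj_point (column 3 A)))"
  using breve_le_iff_idempotent[OF normal] good_triangle_iff_breve_le[OF assms] by blast

end
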